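(* Let $n,m,d\ge 1$, $f:\mathbb{R}^n\to\mathbb{R}$ and $g=(g_1,\dots,g_m):\mathbb{R}^n\to\mathbb{R}^{md}$ with $g_i:\mathbb{R}^n\to\mathbb{R}^d$. Let $r(\mathbf{x})=\sum_{i=1}^m\|g_i(\mathbf{x})\|$ and $F=f+r$. Assume: (A1) $g$ is continuously differentiable and there is $L_g>0$ with $\|\nabla g(\mathbf{x}_1)-\nabla g(\mathbf{x}_2)\|\le L_g\|\mathbf{x}_1-\mathbf{x}_2\|$ for all $\mathbf{x}_1,\mathbf{x}_2\in\mathbb{R}^n$; (A2) $\sup_{\mathbf{x}\in\mathbb{R}^n}\|\nabla g(\mathbf{x})\|\le M$ for some constant $M>0$; (A3) $f$ is continuously differentiable and $\nabla f$ is Lipschitz continuous with constant $L_f$; (A4) $F$ is coercive, i.e. $F(\mathbf{x})\to\infty$ as $\|\mathbf{x}\|\to\infty$. For $\eta>0$ let $F_\eta=f+r_\eta$ be the smoothed objective and put $L_\eta:=L_f+mL_g+\frac{M^2}{\eta}$. Let $\mathbf{x}^0\in\mathbb{R}^n$ be any initial point, let $\alpha>\beta>1$ be constants, and let $\{\mathbf{x}^k\}$, $\{\mathbf{v}^k\}$ be generated by the Res-GD algorithm (defined in the context) with step sizes satisfying $(\alpha L_\eta)^{-1}\le\alpha_k\le(\beta L_\eta)^{-1}$ for all $k$. Then: 1. The sequence $\{\mathbf{x}^k\}$ is bounded. The function $F_\eta$ takes the same value, denoted by $F_\eta^*$, at all accumulation points of $\{\mathbf{x}^k\}$. Moreover,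 every accumulation point $\mathbf{x}^*$ of $\{\mathbf{x}^k\}$ satisfies $\nabla F_\eta(\mathbf{x}^* )=0$. 2. For any $\epsilon>0$ there exists $k\le\left\lfloor\frac{2\alpha^2L_\eta(F(\mathbf{x}^0)-F_\eta^* )}{(\beta-1)\epsilon^2}\right\rfloor+1$ such that $\|\nabla F_\eta(\mathbf{x}^k)\|\le\epsilon$. 3. For any $\epsilon>0$, if $\eta=\epsilon$ (that is, the algorithm is run with smoothing parameter $\eta=\epsilon$), then there exists $k\le\left\lfloor\frac{2(F_\eta(\mathbf{x}^0)-F_\eta^* )\alpha^2(L_f+mL_g+M^2/\epsilon)}{(\beta-1)\epsilon^2}\right\rfloor+1=O(\epsilon^{-3})$ such that $\mathbf{x}^k$ is an $\epsilon$-KKT solution to $\min_{\mathbf{x}\in\mathbb{R}^n}F(\mathbf{x})$.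
   Context: Norms: $\|\cdot\|$ is the Euclidean norm for vectors and the induced 2-norm for matrices. $\nabla g(\mathbf{x})\in\mathbb{R}^{md\times n}$ is the Jacobian of $g$ and $\nabla g_i(\mathbf{x})\in\mathbb{R}^{d\times n}$ the Jacobian of $g_i$. The product $g_i(\mathbf{x})\nabla g_i(\mathbf{x})$ denotes the vector $\nabla g_i(\mathbf{x})^\top g_i(\mathbf{x})\in\mathbb{R}^n$. Smoothing: let $Y=\{\mathbf{y}=(\mathbf{y}_1,\dots,\mathbf{y}_m)\in\mathbb{R}^{md}: \mathbf{y}_i\in\mathbb{R}^d,\ \|\mathbf{y}_i\|\le1\ \forall i\}$. For $\eta>0$, $$r_\eta(\mathbf{x})=\max_{\mathbf{y}\in Y}\ \langle g(\mathbf{x}),\mathbf{y}\rangle-\frac{\eta}{2}\|\mathbf{y}\|^2=\sum_{i:\|g_i(\mathbf{x})\|\le\eta}\frac{1}{2\eta}\|g_i(\mathbf{x})\|^2+\sum_{i:\|g_i(\mathbf{x})\|>\eta}\Big(\|g_i(\mathbf{x})\|-\frac{\eta}{2}\Big),$$ which is differentiable with $$\nabla r_\eta(\mathbf{x})=\sum_{i:\|g_i(\mathbf{x})\|\le\eta}\frac1\eta\, g_i(\mathbf{x})\nabla g_i(\mathbf{x})+\sum_{i:\|g_i(\mathbf{x})\|>\eta}\frac{g_i(\mathbf{x})}{\|g_i(\mathbf{x})\|}\nabla g_i(\mathbf{x}).$$ Res-GD algorithm with smoothing parameter $\eta>0$, step sizes $\alpha_k>0$, $\beta_k>0$, and $\gamma_k=\frac{\alpha_k\beta_k}{\alpha_k+\beta_k}$: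 starting from $\mathbf{x}^0$, for $k=0,1,2,\dots$ compute $$\mathbf{b}^k=\mathbf{x}^k-\alpha_k\nabla f(\mathbf{x}^k),\qquad \mathbf{u}^{k+1}=\mathbf{b}^k-\gamma_k\nabla r_\eta(\mathbf{b}^k),\qquad \mathbf{v}^{k+1}=\mathbf{b}^k-\alpha_k\nabla r_\eta(\mathbf{x}^k),$$ and set $\mathbf{x}^{k+1}=\mathbf{u}^{k+1}$ if $F_\eta(\mathbf{u}^{k+1})\le F_\eta(\mathbf{v}^{k+1})$, and $\mathbf{x}^{k+1}=\mathbf{v}^{k+1}$ otherwise. $\epsilon$-KKT solution: for $\epsilon\ge0$, a point $\hat{\mathbf{x}}\in\mathbb{R}^n$ is called an $\epsilon$-KKT solution to $\min_{\mathbf{x}}F(\mathbf{x})$ if there exist real numbers $\mu_i,\lambda_i,y_i$, $i=1,\dots,m$, such that - $\big\|\nabla f(\hat{\mathbf{x}})+2\sum_{i=1}^m\mu_i\, g_i(\hat{\mathbf{x}})\nabla g_i(\hat{\mathbf{x}})\big\|\le\epsilon$; - $1-2\mu_iy_i-\lambda_i=0$ for all $i$; - $|\mu_i(\|g_i(\hat{\mathbf{x}})\|^2-y_i^2)|\le\epsilon$ for all $i$; - $\lambda_iy_i=0$ for all $i$; - $\lambda_i\ge0$ and $\mu_i\ge0$ for all $i$; - $y_i\ge\|g_i(\hat{\mathbf{x}})\|$ for all $i$. In item 3, the $O(\epsilon^{-3})$ is as $\epsilon\to0$ with $f,g,\mathbf{x}^0,\alpha,\beta$ (and the constants $L_f,L_g,M,m$)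 fixed. *)

theory Defs
  imports "HOL-Analysis.Analysis" "HOL-Library.Landau_Symbols"
begin

definition grad :: "('a::real_inner \<Rightarrow> real) \<Rightarrow> 'a \<Rightarrow> 'a" where
  "grad h x = (THE D. GDERIV h x :> D)"

text \<open>The Jacobian is kept as a bounded linear map, so that \<open>norm (Jac h x)\<close> is the induced 2-norm.
  Its transpose is the \<open>adjoint\<close>. A vector of \<open>\<real>\<^sup>m\<^sup>d\<close> is an element of \<open>real^'d^'m\<close>, whose norm
  and inner product are the Euclidean ones; its block with index \<open>i\<close> is \<open>y $ i\<close>.\<close>

definition Jac :: "('a::euclidean_space \<Rightarrow> 'b::euclidean_space) \<Rightarrow> 'a \<Rightarrow> 'a \<Rightarrow>\<^sub>L 'b" where
  "Jac h x = Blinfun (frechet_derivative h (at x))"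

definition continuously_differentiable ::
    "('a::euclidean_space \<Rightarrow> 'b::euclidean_space) \<Rightarrow> bool" where
  "continuously_differentiable h \<longleftrightarrow>
     (\<forall>x. h differentiable (at x)) \<and> continuous_on UNIV (Jac h)"

definition accumulation_points :: "(nat \<Rightarrow> 'a::topological_space) \<Rightarrow> 'a set" where
  "accumulation_points X = {p. \<exists>s. strict_mono s \<and> (X \<circ> s) \<longlonglongrightarrow> p}"

definition r_fun :: "(real^'n \<Rightarrow> real^'d^'m) \<Rightarrow> real^'n \<Rightarrow> real" where
  "r_fun g x = (\<Sum>i\<in>UNIV. norm (g x $ i))"

definition F_fun :: "(real^'n \<Rightarrow> real) \<Rightarrow> (real^'n \<Rightarrow> real^'d^'m) \<Rightarrow> real^'n \<Rightarrow> real" where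
  "F_fun f g x = f x + r_fun g x"

definition Y_set :: "(real^'d^'m) set" where
  "Y_set = {y. \<forall>i. norm (y $ i) \<le> 1}"

definition r_smooth :: "real \<Rightarrow> (real^'n \<Rightarrow> real^'d^'m) \<Rightarrow> real^'n \<Rightarrow> real" where
  "r_smooth \<eta> g x = (SUP y\<in>Y_set. g x \<bullet> y - \<eta> / 2 * (norm y)\<^sup>2)"

definition F_smooth ::
    "real \<Rightarrow> (real^'n \<Rightarrow> real) \<Rightarrow> (real^'n \<Rightarrow> real^'d^'m) \<Rightarrow> real^'n \<Rightarrow> real" where
  "F_smooth \<eta> f g x = f x + r_smooth \<eta> g x"

definition res_gd_step ::
    "real \<Rightarrow> (real^'n \<Rightarrow> real) \<Rightarrow> (real^'n \<Rightarrow> real^'d^'m) \<Rightarrow> real \<Rightarrow> real \<Rightarrow> real^'n \<Rightarrow> real^'n" where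
  "res_gd_step \<eta> f g a b x =
     (let \<gamma> = a * b / (a + b);
          p = x - a *\<^sub>R grad f x;
          u = p - \<gamma> *\<^sub>R grad (r_smooth \<eta> g) p;
          v = p - a *\<^sub>R grad (r_smooth \<eta> g) x
      in if F_smooth \<eta> f g u \<le> F_smooth \<eta> f g v then u else v)"

primrec res_gd ::
    "real \<Rightarrow> (real^'n \<Rightarrow> real) \<Rightarrow> (real^'n \<Rightarrow> real^'d^'m) \<Rightarrow> (nat \<Rightarrow> real) \<Rightarrow> (nat \<Rightarrow> real) \<Rightarrow>
     real^'n \<Rightarrow> nat \<Rightarrow> real^'n" where
  "res_gd \<eta> f g as bs x0 0 = x0"
| "res_gd \<eta> f g as bs x0 (Suc k) = res_gd_step \<eta> f g (as k) (bs k) (res_gd \<eta> f g as bs x0 k)"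

text \<open>The common value of \<open>F_smooth \<eta> f g\<close> at the accumulation points of the iterates; it is only
  meaningful once these points exist and all have the same value.\<close>

definition F_star ::
    "real \<Rightarrow> (real^'n \<Rightarrow> real) \<Rightarrow> (real^'n \<Rightarrow> real^'d^'m) \<Rightarrow> (nat \<Rightarrow> real) \<Rightarrow> (nat \<Rightarrow> real) \<Rightarrow>
     real^'n \<Rightarrow> real" where
  "F_star \<eta> f g as bs x0 =
     the_elem (F_smooth \<eta> f g ` accumulation_points (res_gd \<eta> f g as bs x0))"

definition L_smooth :: "real \<Rightarrow> real \<Rightarrow> real \<Rightarrow> nat \<Rightarrow> real \<Rightarrow> real" where
  "L_smooth L\<^sub>f L\<^sub>g M m \<eta> = L\<^sub>f + real m * L\<^sub>g + M\<^sup>2 / \<eta>"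

definition admissible_steps ::
    "real \<Rightarrow> real \<Rightarrow> real \<Rightarrow> (nat \<Rightarrow> real) \<Rightarrow> (nat \<Rightarrow> real) \<Rightarrow> bool" where
  "admissible_steps \<alpha> \<beta> L as bs \<longleftrightarrow>
     (\<forall>k. 0 < as k \<and> 0 < bs k \<and> inverse (\<alpha> * L) \<le> as k \<and> as k \<le> inverse (\<beta> * L))"

definition eps_KKT ::
    "(real^'n \<Rightarrow> real) \<Rightarrow> (real^'n \<Rightarrow> real^'d^'m) \<Rightarrow> real \<Rightarrow> real^'n \<Rightarrow> bool" where
  "eps_KKT f g \<epsilon> x \<longleftrightarrow>
     (\<exists>\<mu> lam y :: 'm \<Rightarrow> real.
        norm (grad f x +
              2 *\<^sub>R (\<Sum>i\<in>UNIV. \<mu> i *\<^sub>R adjoint (blinfun_apply (Jac (\<lambda>z. g z $ i) x)) (g x $ i))) \<le> \<epsilon> \<and>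
        (\<forall>i. 1 - 2 * \<mu> i * y i - lam i = 0) \<and>
        (\<forall>i. \<bar>\<mu> i * ((norm (g x $ i))\<^sup>2 - (y i)\<^sup>2)\<bar> \<le> \<epsilon>) \<and>
        (\<forall>i. lam i * y i = 0) \<and>
        (\<forall>i. lam i \<ge> 0 \<and> \<mu> i \<ge> 0) \<and>
        (\<forall>i. y i \<ge> norm (g x $ i)))"

text \<open>The iteration bound for reaching an \<open>\<epsilon>\<close>-KKT point; the smoothing parameter is \<open>\<epsilon>\<close> itself.\<close>

definition KKT_bound ::
    "(real^'n \<Rightarrow> real) \<Rightarrow> (real^'n \<Rightarrow> real^'d^'m) \<Rightarrow> real \<Rightarrow> real \<Rightarrow> real \<Rightarrow> real \<Rightarrow> real \<Rightarrow>
     (nat \<Rightarrow> real) \<Rightarrow> (nat \<Rightarrow> real) \<Rightarrow> real^'n \<Rightarrow> real \<Rightarrow> int" where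
  "KKT_bound f g L\<^sub>f L\<^sub>g M \<alpha> \<beta> as bs x0 \<epsilon> =
     \<lfloor>2 * (F_smooth \<epsilon> f g x0 - F_star \<epsilon> f g as bs x0) * \<alpha>\<^sup>2 *
       (L\<^sub>f + real CARD('m) * L\<^sub>g + M\<^sup>2 / \<epsilon>) / ((\<beta> - 1) * \<epsilon>\<^sup>2)\<rfloor> + 1"

end

theory Submission
  imports Defs
begin

text \<open>The smoothed penalty is \<open>\<phi> \<circ> g\<close>, where \<open>\<phi>\<close> is the smooth convex function
  \<open>\<phi> z = max y\<in>Y. z \<bullet> y - \<eta> / 2 * (norm y)\<^sup>2\<close>. Its maximiser is a \<open>1 / \<eta>\<close>-Lipschitz function of \<open>z\<close>
  and is the gradient of \<open>\<phi>\<close>, so the gradient of \<open>F_smooth\<close> is Lipschitz with constant \<open>L_smooth\<close>.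
  The candidate \<open>v\<close> is a plain gradient step for \<open>F_smooth\<close>, hence the iteration decreases \<open>F_smooth\<close>
  by at least a multiple of the squared gradient norm whichever candidate is chosen. Convergence and
  complexity follow from this sufficient decrease alone. With \<open>\<eta> = \<epsilon>\<close>, the maximiser at a point with
  gradient of norm at most \<open>\<epsilon>\<close> provides the multipliers of an \<open>\<epsilon>\<close>-KKT point.\<close>

section \<open>Gradients, Jacobians and adjoints\<close>

lemma GDERIV_unique:
  fixes h :: "'a::real_inner \<Rightarrow> real"
  assumes "GDERIV h x :> D" "GDERIV h x :> E"
  shows "D = E"
proof -
  have "(\<lambda>v. v \<bullet> D) = (\<lambda>v. v \<bullet> E)"
    using assms has_derivative_unique unfolding gderiv_def by blast
  then have "v \<bullet> D = v \<bullet> E" for v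
    by metis
  then show ?thesis
    using vector_eq_ldot by blast
qed

lemma grad_eqI:
  fixes h :: "'a::real_inner \<Rightarrow> real"
  assumes "GDERIV h x :> D"
  shows "grad h x = D"
  unfolding grad_def using assms GDERIV_unique by (blast intro: the_equality)

text \<open>\<open>grad\<close> is a definite description, so a gradient has to be exhibited: the
  derivative \<open>h'\<close> is a linear functional, represented by the vector
  \<open>adjoint h' 1\<close>.\<close>

lemma GDERIV_grad:
  fixes h :: "'a::euclidean_space \<Rightarrow> real"
  assumes "h differentiable (at x)"
  shows "GDERIV h x :> grad h x"
proof -
  obtain h' where h': "(h has_derivative h') (at x)"
    using assms differentiable_def by blast
  then have "linear h'"
    by (rule has_derivative_linear)
  then have "h' = (\<lambda>v. v \<bullet> adjoint h' 1)"
    using adjoint_works[of h'] by fastforce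
  then have "GDERIV h x :> adjoint h' 1"
    using h' unfolding gderiv_def by metis
  then show ?thesis
    by (simp add: grad_eqI)
qed

lemma Jac_has_derivative:
  fixes h :: "'a::euclidean_space \<Rightarrow> 'b::euclidean_space"
  assumes "h differentiable (at x)"
  shows "(h has_derivative blinfun_apply (Jac h x)) (at x)"
proof -
  have d: "(h has_derivative frechet_derivative h (at x)) (at x)"
    using assms frechet_derivative_works by blast
  then show ?thesis
    unfolding Jac_def by (simp add: bounded_linear_Blinfun_apply has_derivative_bounded_linear)
qed

lemma Jac_component:
  fixes h :: "'a::euclidean_space \<Rightarrow> real^'d^'m"
  assumes "h differentiable (at x)"
  shows "blinfun_apply (Jac (\<lambda>z. h z $ i) x) v = blinfun_apply (Jac h x) v $ i"
proof -
  have d: "((\<lambda>z. h z $ i) has_derivative (\<lambda>v. blinfun_apply (Jac h x) v $ i)) (at x)"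
    using bounded_linear.has_derivative[OF bounded_linear_vec_nth Jac_has_derivative[OF assms]] .
  then have "((\<lambda>z. h z $ i) has_derivative blinfun_apply (Jac (\<lambda>z. h z $ i) x)) (at x)"
    using Jac_has_derivative differentiable_def by blast
  with d show ?thesis
    using has_derivative_unique by metis
qed

lemma inner_adjoint_blinfun:
  fixes A :: "'a::euclidean_space \<Rightarrow>\<^sub>L 'b::euclidean_space"
  shows "v \<bullet> adjoint (blinfun_apply A) y = blinfun_apply A v \<bullet> y"
  by (simp add: adjoint_works blinfun.bounded_linear_right bounded_linear.linear)

text \<open>Let w be the adjoint applied to \<open>y\<close>. Its squared norm is the inner product
  of the image of w under \<open>A\<close> with \<open>y\<close>; Cauchy-Schwarz applies and one
  factor \<open>norm w\<close> cancels.\<close>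

lemma norm_adjoint_blinfun_le:
  fixes A :: "'a::euclidean_space \<Rightarrow>\<^sub>L 'b::euclidean_space"
  shows "norm (adjoint (blinfun_apply A) y) \<le> norm A * norm y"
proof -
  let ?w = "adjoint (blinfun_apply A) y"
  have "norm ?w * norm ?w = blinfun_apply A ?w \<bullet> y"
    by (metis inner_adjoint_blinfun norm_eq_square power2_norm_eq_inner power2_eq_square)
  also have "\<dots> \<le> norm (blinfun_apply A ?w) * norm y"
    by (rule norm_cauchy_schwarz)
  also have "\<dots> \<le> norm A * norm ?w * norm y"
    by (intro mult_right_mono norm_blinfun) auto
  finally have "norm ?w * norm ?w \<le> (norm A * norm y) * norm ?w"
    by (simp add: mult_ac)
  then show ?thesis
    by (cases "norm ?w = 0") (auto simp: mult_le_cancel_right)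
qed

text \<open>Separates a change of the Jacobian from a change of the vector, so that the two can be
  estimated independently when the gradient of the penalty is compared at two points.\<close>

lemma adjoint_diff_split:
  fixes A B :: "'a::euclidean_space \<Rightarrow>\<^sub>L 'b::euclidean_space"
  shows "adjoint (blinfun_apply A) y - adjoint (blinfun_apply B) z =
    adjoint (blinfun_apply (A - B)) y + adjoint (blinfun_apply B) (y - z)"
proof -
  have "v \<bullet> (adjoint (blinfun_apply A) y - adjoint (blinfun_apply B) z) =
    v \<bullet> (adjoint (blinfun_apply (A - B)) y + adjoint (blinfun_apply B) (y - z))" for v
    by (simp add: inner_adjoint_blinfun inner_diff_left inner_diff_right inner_add_right
        blinfun.diff_left)
  then show ?thesis
    using vector_eq_ldot by blast
qed

section \<open>Descent along gradient steps\<close>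

text \<open>On the segment from \<open>x\<close> to \<open>x + d\<close>, \<open>F\<close> minus the
  linear and quadratic terms of the bound has a nonpositive derivative, because the Lipschitz
  condition lets the slope grow by at most \<open>L * t * (norm d)\<^sup>2\<close>. Comparing the
  parameters 1 and 0 finishes.\<close>

lemma descent_lemma:
  fixes F :: "'a::real_inner \<Rightarrow> real"
  assumes der: "\<And>x. GDERIV F x :> G x" and lip: "L-lipschitz_on UNIV G"
  shows "F (x + d) \<le> F x + G x \<bullet> d + L / 2 * (norm d)\<^sup>2"
proof -
  let ?h = "\<lambda>t. F (x + t *\<^sub>R d) - t * (G x \<bullet> d) - L / 2 * t\<^sup>2 * (norm d)\<^sup>2"
  let ?h' = "\<lambda>t. d \<bullet> G (x + t *\<^sub>R d) - G x \<bullet> d - L * t * (norm d)\<^sup>2"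
  have D: "(?h has_real_derivative ?h' t) (at t)" for t
  proof -
    have "((\<lambda>t. F (x + t *\<^sub>R d)) has_derivative (\<lambda>s. (s *\<^sub>R d) \<bullet> G (x + t *\<^sub>R d))) (at t)"
      by (rule has_derivative_compose[where f = "\<lambda>t. x + t *\<^sub>R d" and g = F])
        (use der gderiv_def in \<open>auto intro!: derivative_eq_intros\<close>)
    then have "((\<lambda>t. F (x + t *\<^sub>R d)) has_real_derivative d \<bullet> G (x + t *\<^sub>R d)) (at t)"
      unfolding has_field_derivative_def by (simp add: mult_commute_abs)
    then show ?thesis
      by (auto intro!: derivative_eq_intros)
  qed
  have "?h' t \<le> 0" if "0 \<le> t" for t
  proof -
    have "d \<bullet> G (x + t *\<^sub>R d) - G x \<bullet> d = d \<bullet> (G (x + t *\<^sub>R d) - G x)"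
      by (simp add: inner_diff_right inner_commute)
    also have "\<dots> \<le> norm d * norm (G (x + t *\<^sub>R d) - G x)"
      by (rule norm_cauchy_schwarz)
    also have "\<dots> \<le> norm d * (L * norm (t *\<^sub>R d))"
      using lipschitz_onD[OF lip, of "x + t *\<^sub>R d" x]
      by (intro mult_left_mono) (auto simp: dist_norm)
    also have "\<dots> = L * t * (norm d)\<^sup>2"
      using that by (simp add: power2_eq_square)
    finally show ?thesis by simp
  qed
  with D have "?h 1 \<le> ?h 0"
    by (intro DERIV_nonpos_imp_nonincreasing[of 0 1 ?h]) (simp, blast)
  then show ?thesis
    by simp
qed

text \<open>The upper bound on \<open>a\<close> gives \<open>L * a \<le> 1\<close>, so the descent
  lemma retains at least \<open>a / 2\<close>, hence at least
  \<open>inverse (\<alpha> * L) / 2\<close>. The stated constant is this value times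
  \<open>(\<beta> - 1) / \<alpha>\<close>, a factor below 1; its form is dictated by the iteration
  bounds.\<close>

lemma gradient_step_decrease:
  fixes F :: "'a::real_inner \<Rightarrow> real"
  assumes der: "\<And>x. GDERIV F x :> G x" and lip: "L-lipschitz_on UNIV G"
    and L: "L > 0" and step_consts: "\<beta> > 1" "\<alpha> > \<beta>"
    and a: "inverse (\<alpha> * L) \<le> a" "a \<le> inverse (\<beta> * L)"
  shows "F (x - a *\<^sub>R G x) \<le> F x - (\<beta> - 1) / (2 * \<alpha>\<^sup>2 * L) * (norm (G x))\<^sup>2"
proof -
  have "a > 0"
    using a(1) L step_consts by (smt (verit) inverse_positive_iff_positive zero_less_mult_iff)
  have "L * a \<le> inverse \<beta>"
    using mult_left_mono[OF a(2), of L] L by (simp add: field_simps)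
  also have "inverse \<beta> \<le> 1"
    using step_consts by (simp add: inverse_le_1_iff)
  finally have La: "L * a \<le> 1" .
  have "(\<beta> - 1) / (2 * \<alpha>\<^sup>2 * L) = ((\<beta> - 1) / \<alpha>) * (inverse (\<alpha> * L) / 2)"
    by (simp add: field_simps power2_eq_square)
  also have "\<dots> \<le> 1 * (inverse (\<alpha> * L) / 2)"
    using step_consts L by (intro mult_right_mono) auto
  also have "\<dots> \<le> a / 2"
    using a(1) by simp
  also have "\<dots> \<le> a - L / 2 * a\<^sup>2"
    using mult_right_mono[OF La, of a] \<open>a > 0\<close> by (simp add: power2_eq_square)
  finally have c: "(\<beta> - 1) / (2 * \<alpha>\<^sup>2 * L) \<le> a - L / 2 * a\<^sup>2" .
  have "F (x - a *\<^sub>R G x) \<le> F x - (a - L / 2 * a\<^sup>2) * (norm (G x))\<^sup>2"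
    using descent_lemma[OF der lip, of x "- (a *\<^sub>R G x)"]
    by (simp add: power_mult_distrib power2_norm_eq_inner algebra_simps)
  then show ?thesis
    using mult_right_mono[OF c, of "(norm (G x))\<^sup>2"] by simp
qed

section \<open>Sequences with sufficient decrease\<close>

text \<open>The values decrease and a subsequence of them converges to \<open>F p\<close>, so all of
  them do. Their successive differences then tend to 0 and squeeze the squared gradient norms;
  continuity of \<open>G\<close> carries this to \<open>p\<close>.\<close>

lemma sufficient_decrease_accumulation:
  fixes F :: "'a::topological_space \<Rightarrow> real" and G :: "'a \<Rightarrow> 'b::real_normed_vector"
  assumes dec: "\<And>k. F (X (Suc k)) \<le> F (X k) - c * (norm (G (X k)))\<^sup>2" and c: "c > 0"
    and F: "continuous_on UNIV F" and G: "continuous_on UNIV G"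
    and p: "p \<in> accumulation_points X"
  shows "(\<lambda>k. F (X k)) \<longlonglongrightarrow> F p" and "F p \<le> F (X k)" and "G p = 0"
proof -
  have Fdec: "decseq (\<lambda>k. F (X k))"
    using dec c by (intro decseq_SucI) (smt (verit) mult_nonneg_nonneg zero_le_power2)
  obtain s where s: "strict_mono s" "(X \<circ> s) \<longlonglongrightarrow> p"
    using p unfolding accumulation_points_def by blast
  have Fs: "(\<lambda>j. F (X (s j))) \<longlonglongrightarrow> F p"
    using continuous_on_tendsto_compose[OF F s(2)] by (simp add: o_def)
  show le: "F p \<le> F (X k)" for k
  proof (rule LIMSEQ_le_const2[OF Fs])
    \<comment> \<open>\<open>N = k\<close> works: a strictly increasing \<open>s\<close> satisfies
      \<open>n \<le> s n\<close>.\<close>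
    show "\<exists>N. \<forall>n\<ge>N. F (X (s n)) \<le> F (X k)"
      using decseqD[OF Fdec] seq_suble[OF s(1)] order_trans by blast
  qed
  obtain l where l: "(\<lambda>k. F (X k)) \<longlonglongrightarrow> l"
    using decseq_convergent[OF Fdec, of "F p"] le by blast
  then show lim: "(\<lambda>k. F (X k)) \<longlonglongrightarrow> F p"
    using LIMSEQ_subseq_LIMSEQ[OF l s(1)] Fs LIMSEQ_unique unfolding o_def by blast
  have "(\<lambda>k. (F (X k) - F (X (Suc k))) / c) \<longlonglongrightarrow> (F p - F p) / c"
    using lim LIMSEQ_Suc[OF lim] c by (intro tendsto_intros) auto
  then have lim0: "(\<lambda>k. (F (X k) - F (X (Suc k))) / c) \<longlonglongrightarrow> 0"
    by simp
  have "(norm (G (X k)))\<^sup>2 \<le> (F (X k) - F (X (Suc k))) / c" for k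
    using dec[of k] c by (simp add: field_simps)
  then have "(\<lambda>k. (norm (G (X k)))\<^sup>2) \<longlonglongrightarrow> 0"
    by (intro tendsto_sandwich[OF _ _ tendsto_const lim0]) auto
  then have "(\<lambda>j. (norm (G (X (s j))))\<^sup>2) \<longlonglongrightarrow> 0"
    using LIMSEQ_subseq_LIMSEQ[OF _ s(1)] unfolding o_def by blast
  moreover have "(\<lambda>j. (norm (G (X (s j))))\<^sup>2) \<longlonglongrightarrow> (norm (G p))\<^sup>2"
    using continuous_on_tendsto_compose[OF G s(2)] by (intro tendsto_intros) (simp add: o_def)
  ultimately have "(norm (G p))\<^sup>2 = 0"
    using LIMSEQ_unique by blast
  then show "G p = 0"
    by simp
qed

text \<open>While the gradient norm exceeds \<open>\<epsilon>\<close>, each step lowers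
  \<open>F\<close> by at least \<open>c * \<epsilon>\<^sup>2\<close>, and at most \<open>B\<close>
  such steps fit above the lower bound \<open>l\<close>.\<close>

lemma sufficient_decrease_complexity:
  fixes F :: "'a \<Rightarrow> real" and G :: "'a \<Rightarrow> 'b::real_normed_vector"
  assumes dec: "\<And>k. F (X (Suc k)) \<le> F (X k) - c * (norm (G (X k)))\<^sup>2" and c: "c > 0"
    and low: "\<And>k. l \<le> F (X k)" and \<epsilon>: "\<epsilon> > 0" and B: "(F (X 0) - l) / (c * \<epsilon>\<^sup>2) \<le> B"
  shows "\<exists>k. int k \<le> \<lfloor>B\<rfloor> + 1 \<and> norm (G (X k)) \<le> \<epsilon>"
proof (rule ccontr)
  assume neg: "\<not> ?thesis"
  \<comment> \<open>The range ends one past that of the negated claim, since the bound at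
    \<open>n\<close> involves gradients only up to index \<open>n - 1\<close>.\<close>
  have desc: "F (X n) \<le> F (X 0) - real n * (c * \<epsilon>\<^sup>2)" if "int n \<le> \<lfloor>B\<rfloor> + 2" for n
    using that
  proof (induction n)
    case (Suc n)
    then have "norm (G (X n)) > \<epsilon>"
      using neg by (smt (verit) of_nat_Suc)
    then have "c * \<epsilon>\<^sup>2 \<le> c * (norm (G (X n)))\<^sup>2"
      using c \<epsilon> by (intro mult_left_mono power_mono) auto
    then show ?case
      using Suc dec[of n] by (simp add: algebra_simps)
  qed simp
  have "0 \<le> (F (X 0) - l) / (c * \<epsilon>\<^sup>2)"
    using low[of 0] c by simp
  then have "0 \<le> B"
    using B by linarith
  \<comment> \<open>This count exceeds \<open>B\<close>, which contradicts the available decrease;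
    \<open>0 \<le> B\<close> keeps \<open>nat\<close> from truncating.\<close>
  define N where "N = nat (\<lfloor>B\<rfloor> + 2)"
  have N: "int N = \<lfloor>B\<rfloor> + 2"
    using \<open>0 \<le> B\<close> by (simp add: N_def)
  have "real N * (c * \<epsilon>\<^sup>2) \<le> F (X 0) - l"
    using desc[of N] low[of N] N by simp
  then have "real N \<le> (F (X 0) - l) / (c * \<epsilon>\<^sup>2)"
    using c \<epsilon> by (simp add: pos_le_divide_eq)
  with B have "real N \<le> B"
    by simp
  then have "int N \<le> \<lfloor>B\<rfloor>"
    by (simp add: le_floor_iff)
  with N show False
    by simp
qed

section \<open>The projection onto a product of unit balls\<close>

text \<open>The maximiser of \<open>z \<bullet> y - \<eta> / 2 * (norm y)\<^sup>2\<close> over \<open>y \<in> Y_set\<close>, that is, the projection of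
  \<open>z / \<eta>\<close> onto \<open>Y_set\<close>.\<close>

definition Y_proj :: "real \<Rightarrow> real^'d^'m \<Rightarrow> real^'d^'m" where
  "Y_proj \<eta> z = (\<chi> i. (1 / max \<eta> (norm (z $ i))) *\<^sub>R (z $ i))"

lemma Y_proj_in_Y_set:
  assumes "\<eta> > 0"
  shows "Y_proj \<eta> z \<in> Y_set"
  using assms by (auto simp: Y_set_def Y_proj_def divide_simps)

text \<open>The first bound controls the gap between \<open>r_smooth\<close> and
  \<open>r_fun\<close>; the second produces the factor \<open>real CARD('m)\<close> in the Lipschitz
  constant of the gradient.\<close>

lemma norm_Y_set_le:
  fixes y :: "real^'d^'m"
  assumes "y \<in> Y_set"
  shows "(norm y)\<^sup>2 \<le> real CARD('m)" and "norm y \<le> real CARD('m)"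
proof -
  have n: "norm (y $ i) \<le> 1" for i
    using assms by (simp add: Y_set_def)
  have "(norm y)\<^sup>2 = (\<Sum>i\<in>UNIV. (norm (y $ i))\<^sup>2)"
    by (simp add: power2_norm_eq_inner inner_vec_def)
  also have "\<dots> \<le> (\<Sum>i\<in>(UNIV::'m set). 1)"
    using n by (intro sum_mono) (simp add: power_le_one)
  finally show "(norm y)\<^sup>2 \<le> real CARD('m)"
    by simp
  have "norm y \<le> (\<Sum>i\<in>UNIV. norm (y $ i))"
    by (simp add: norm_vec_def L2_set_le_sum)
  also have "\<dots> \<le> (\<Sum>i\<in>(UNIV::'m set). 1)"
    using n by (intro sum_mono) auto
  finally show "norm y \<le> real CARD('m)"
    by simp
qed

text \<open>First-order optimality of the maximiser, checked block by block because
  \<open>Y_set\<close> is a product. In a block of norm at most \<open>\<eta>\<close> the residual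
  vanishes; otherwise it is a nonnegative multiple of the block \<open>w\<close>, and among vectors
  of the unit ball \<open>w / norm w\<close> has the largest inner product with
  \<open>w\<close>.\<close>

lemma Y_proj_variational:
  fixes z :: "real^'d^'m"
  assumes \<eta>: "\<eta> > 0" and y: "y \<in> Y_set"
  shows "(z - \<eta> *\<^sub>R Y_proj \<eta> z) \<bullet> (y - Y_proj \<eta> z) \<le> 0"
proof -
  have "(z $ i - \<eta> *\<^sub>R Y_proj \<eta> z $ i) \<bullet> (y $ i - Y_proj \<eta> z $ i) \<le> 0" for i
  proof (cases "norm (z $ i) \<le> \<eta>")
    case True
    then show ?thesis
      using \<eta> by (simp add: Y_proj_def max_def)
  next
    case False
    define w where "w = z $ i"
    have w: "norm w > \<eta>"
      using False by (simp add: w_def)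
    have "w \<bullet> y $ i \<le> norm w * norm (y $ i)"
      by (rule norm_cauchy_schwarz)
    also have "\<dots> \<le> norm w * 1"
      using y by (intro mult_left_mono) (auto simp: Y_set_def)
    finally have "w \<bullet> y $ i \<le> norm w" by simp
    moreover have "w \<bullet> ((1 / norm w) *\<^sub>R w) = norm w"
      using w \<eta> by (simp add: dot_square_norm power2_eq_square)
    ultimately have "w \<bullet> (y $ i - (1 / norm w) *\<^sub>R w) \<le> 0"
      by (simp add: inner_diff_right)
    moreover have "w - \<eta> *\<^sub>R ((1 / norm w) *\<^sub>R w) = (1 - \<eta> / norm w) *\<^sub>R w"
      by (simp add: scaleR_diff_left)
    moreover have "1 - \<eta> / norm w \<ge> 0"
      using w \<eta> by (auto simp: divide_simps)
    ultimately have "(w - \<eta> *\<^sub>R ((1 / norm w) *\<^sub>R w)) \<bullet> (y $ i - (1 / norm w) *\<^sub>R w) \<le> 0"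
      by (simp add: mult_nonneg_nonpos)
    moreover have "Y_proj \<eta> z $ i = (1 / norm w) *\<^sub>R w"
      using w by (simp add: Y_proj_def w_def max_def)
    ultimately show ?thesis
      by (simp only: w_def)
  qed
  then show ?thesis
    by (simp add: inner_vec_def sum_nonpos)
qed

text \<open>Testing the variational inequality at each point with the projection of the other and
  adding gives strong monotonicity,
  \<open>\<eta> * (?d \<bullet> ?d) \<le> (z - z') \<bullet> ?d\<close>; Cauchy-Schwarz does the
  rest.\<close>

lemma Y_proj_lipschitz:
  fixes z z' :: "real^'d^'m"
  assumes \<eta>: "\<eta> > 0"
  shows "norm (Y_proj \<eta> z - Y_proj \<eta> z') \<le> norm (z - z') / \<eta>"
proof -
  let ?d = "Y_proj \<eta> z - Y_proj \<eta> z'"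
  have "\<eta> * (norm ?d * norm ?d) = \<eta> * (?d \<bullet> ?d)"
    by (simp add: dot_square_norm power2_eq_square)
  also have "\<dots> \<le> (z - z') \<bullet> ?d"
    using Y_proj_variational[OF \<eta> Y_proj_in_Y_set[OF \<eta>], of z z']
      Y_proj_variational[OF \<eta> Y_proj_in_Y_set[OF \<eta>], of z' z]
    by (simp add: inner_diff_left inner_diff_right algebra_simps)
  also have "\<dots> \<le> norm (z - z') * norm ?d"
    by (rule norm_cauchy_schwarz)
  finally have "(\<eta> * norm ?d) * norm ?d \<le> norm (z - z') * norm ?d"
    by (simp add: mult_ac)
  then have "\<eta> * norm ?d \<le> norm (z - z')"
    by (cases "norm ?d = 0") (auto simp: mult_le_cancel_right)
  then show ?thesis
    using \<eta> by (simp add: pos_le_divide_eq mult.commute)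
qed

text \<open>Expanding the square, the value at \<open>y\<close> minus the value at \<open>?p\<close>
  is the inner product of the variational inequality minus
  \<open>\<eta> / 2 * (norm (y - ?p))\<^sup>2\<close>.\<close>

lemma Y_proj_maximal:
  fixes z :: "real^'d^'m"
  assumes "\<eta> > 0" "y \<in> Y_set"
  shows "z \<bullet> y - \<eta> / 2 * (norm y)\<^sup>2 \<le>
    z \<bullet> Y_proj \<eta> z - \<eta> / 2 * (norm (Y_proj \<eta> z))\<^sup>2"
proof -
  let ?p = "Y_proj \<eta> z"
  have "0 \<le> \<eta> / 2 * ((y - ?p) \<bullet> (y - ?p))"
    using assms by simp
  then show ?thesis
    using Y_proj_variational[OF assms, of z]
    by (simp add: power2_norm_eq_inner inner_diff_left inner_diff_right inner_commute algebra_simps)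
qed

section \<open>The smoothed penalty: approximation error, gradient and Lipschitz constant\<close>

lemma r_smooth_eq:
  assumes "\<eta> > 0"
  shows "r_smooth \<eta> g x = g x \<bullet> Y_proj \<eta> (g x) - \<eta> / 2 * (norm (Y_proj \<eta> (g x)))\<^sup>2"
  unfolding r_smooth_def
  by (rule cSup_eq_maximum) (use Y_proj_in_Y_set Y_proj_maximal assms in auto)

lemma r_smooth_ge:
  assumes "\<eta> > 0" "y \<in> Y_set"
  shows "g x \<bullet> y - \<eta> / 2 * (norm y)\<^sup>2 \<le> r_smooth \<eta> g x"
  unfolding r_smooth_eq[OF assms(1)] using assms by (rule Y_proj_maximal)

text \<open>The blocks of the maximiser have norm at most 1 and the quadratic term only subtracts.
  This is what lets \<open>F_fun f g x0\<close> replace the smoothed value in an iteration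
  bound.\<close>

lemma r_smooth_le_r_fun:
  assumes "\<eta> > 0"
  shows "r_smooth \<eta> g x \<le> r_fun g x"
proof -
  let ?p = "Y_proj \<eta> (g x)"
  have "g x $ i \<bullet> ?p $ i \<le> norm (g x $ i)" for i
  proof -
    have "g x $ i \<bullet> ?p $ i \<le> norm (g x $ i) * norm (?p $ i)"
      by (rule norm_cauchy_schwarz)
    also have "\<dots> \<le> norm (g x $ i) * 1"
      using Y_proj_in_Y_set[OF assms] by (intro mult_left_mono) (auto simp: Y_set_def)
    finally show ?thesis by simp
  qed
  then have "g x \<bullet> ?p \<le> r_fun g x"
    unfolding inner_vec_def r_fun_def by (rule sum_mono)
  then show ?thesis
    using assms by (smt (verit) r_smooth_eq divide_nonneg_nonneg mult_nonneg_nonneg zero_le_power2)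
qed

text \<open>Testing the supremum with the normalised blocks of \<open>g x\<close> makes the linear
  part equal to \<open>r_fun g x\<close>, at a quadratic cost of at most \<open>\<eta> / 2\<close>
  per block. Boundedness properties of \<open>F_fun\<close> are thereby transferred to
  \<open>F_smooth\<close>.\<close>

lemma r_fun_le_r_smooth:
  fixes g :: "real^'n \<Rightarrow> real^'d^'m"
  assumes "\<eta> > 0"
  shows "r_fun g x - \<eta> / 2 * real CARD('m) \<le> r_smooth \<eta> g x"
proof -
  define y :: "real^'d^'m" where "y = (\<chi> i. sgn (g x $ i))"
  have y: "y \<in> Y_set"
    by (simp add: Y_set_def y_def norm_sgn)
  have "w \<bullet> sgn w = norm w" for w :: "real^'d"
    by (cases "w = 0") (simp_all add: sgn_div_norm dot_square_norm power2_eq_square)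
  then have "g x \<bullet> y = r_fun g x"
    unfolding inner_vec_def[where 'b = 'm] r_fun_def by (simp add: y_def)
  moreover have "\<eta> / 2 * (norm y)\<^sup>2 \<le> \<eta> / 2 * real CARD('m)"
    using norm_Y_set_le[OF y] assms by (intro mult_left_mono) auto
  ultimately show ?thesis
    using r_smooth_ge[OF assms y, of g x] by simp
qed

text \<open>Danskin's theorem: the upper and lower bounds by the maximisers at the two points differ only
  by a quadratic term.\<close>

lemma r_smooth_GDERIV:
  fixes g :: "real^'n \<Rightarrow> real^'d^'m"
  assumes \<eta>: "\<eta> > 0" and g: "g differentiable (at x)"
  shows "GDERIV (r_smooth \<eta> g) x :> adjoint (blinfun_apply (Jac g x)) (Y_proj \<eta> (g x))"
proof -
  define \<phi> :: "real^'d^'m \<Rightarrow> real"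
    where "\<phi> z = z \<bullet> Y_proj \<eta> z - \<eta> / 2 * (norm (Y_proj \<eta> z))\<^sup>2" for z
  \<comment> \<open>The maximiser at \<open>z\<close> competes at \<open>w\<close>, so it is a
    subgradient at \<open>z\<close>; exchanging \<open>z\<close> and \<open>w\<close> yields the
    upper estimate.\<close>
  have low: "\<phi> z + (w - z) \<bullet> Y_proj \<eta> z \<le> \<phi> w" for z w
    using Y_proj_maximal[OF \<eta> Y_proj_in_Y_set[OF \<eta>], of w z]
    by (simp add: \<phi>_def inner_diff_left)
  have bnd: "norm (\<phi> w - \<phi> z - (w - z) \<bullet> Y_proj \<eta> z) \<le> (norm (w - z))\<^sup>2 / \<eta>" for w z
  proof -
    have "\<phi> w - \<phi> z - (w - z) \<bullet> Y_proj \<eta> z \<le> (w - z) \<bullet> (Y_proj \<eta> w - Y_proj \<eta> z)"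
      using low[of w z] by (simp add: inner_diff_left inner_diff_right)
    also have "\<dots> \<le> norm (w - z) * norm (Y_proj \<eta> w - Y_proj \<eta> z)"
      by (rule norm_cauchy_schwarz)
    also have "\<dots> \<le> norm (w - z) * (norm (w - z) / \<eta>)"
      by (intro mult_left_mono Y_proj_lipschitz \<eta>) auto
    finally show ?thesis
      using low[of z w] by (simp add: power2_eq_square)
  qed
  have "(\<phi> has_derivative (\<lambda>h. h \<bullet> Y_proj \<eta> z)) (at z)" for z
    unfolding has_derivative_at_within
  proof
    show "bounded_linear (\<lambda>h. h \<bullet> Y_proj \<eta> z)"
      by (rule bounded_linear_inner_left)
    show "((\<lambda>w. (\<phi> w - \<phi> z - (w - z) \<bullet> Y_proj \<eta> z) /\<^sub>R norm (w - z)) \<longlongrightarrow> 0) (at z)"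
    proof (rule Lim_null_comparison)
      show "\<forall>\<^sub>F w in at z. norm ((\<phi> w - \<phi> z - (w - z) \<bullet> Y_proj \<eta> z) /\<^sub>R norm (w - z))
          \<le> norm (w - z) / \<eta>"
      proof (rule always_eventually, rule allI)
        fix w
        show "norm ((\<phi> w - \<phi> z - (w - z) \<bullet> Y_proj \<eta> z) /\<^sub>R norm (w - z)) \<le> norm (w - z) / \<eta>"
          using bnd[of w z] \<eta> by (cases "w = z") (auto simp: field_simps power2_eq_square)
      qed
      have "((\<lambda>w. norm (w - z) / \<eta>) \<longlongrightarrow> norm (z - z) / \<eta>) (at z)"
        using \<eta> by (intro tendsto_intros) auto
      then show "((\<lambda>w. norm (w - z) / \<eta>) \<longlongrightarrow> 0) (at z)"
        by simp
    qed
  qed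
  from has_derivative_compose[OF Jac_has_derivative[OF g] this]
  have "((\<lambda>x. \<phi> (g x)) has_derivative (\<lambda>h. blinfun_apply (Jac g x) h \<bullet> Y_proj \<eta> (g x))) (at x)" .
  moreover have "r_smooth \<eta> g = (\<lambda>x. \<phi> (g x))"
    using r_smooth_eq[OF \<eta>] by (auto simp: \<phi>_def)
  ultimately show ?thesis
    by (simp add: gderiv_def inner_adjoint_blinfun)
qed

text \<open>The gradient is the transposed Jacobian applied to the maximiser. Varying the Jacobian
  costs \<open>L\<close> times the norm of a point of \<open>Y_set\<close>; varying the maximiser
  costs \<open>M\<close> for the Jacobian, \<open>1 / \<eta>\<close> for \<open>Y_proj\<close> and
  another \<open>M\<close> for \<open>g\<close>.\<close>

lemma grad_r_smooth_lipschitz: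
  fixes g :: "real^'n \<Rightarrow> real^'d^'m"
  assumes \<eta>: "\<eta> > 0" and g: "\<And>x. g differentiable (at x)"
    and lip: "L-lipschitz_on UNIV (Jac g)" and M: "\<And>x. norm (Jac g x) \<le> M"
  shows "(real CARD('m) * L + M\<^sup>2 / \<eta>)-lipschitz_on UNIV (grad (r_smooth \<eta> g))"
proof (rule lipschitz_onI)
  have L: "L \<ge> 0"
    using lip lipschitz_on_nonneg by blast
  have M0: "M \<ge> 0"
    using M[of 0] norm_ge_zero order_trans by blast
  show "0 \<le> real CARD('m) * L + M\<^sup>2 / \<eta>"
    using L \<eta> by simp
  fix x y
  have gr: "grad (r_smooth \<eta> g) z = adjoint (blinfun_apply (Jac g z)) (Y_proj \<eta> (g z))" for z
    using r_smooth_GDERIV[OF \<eta> g] grad_eqI by blast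
  \<comment> \<open>The mean value inequality turns the bound on the Jacobian into a Lipschitz bound
    on \<open>g\<close>.\<close>
  have gl: "norm (g x - g y) \<le> M * norm (x - y)"
  proof (rule differentiable_bound[OF convex_UNIV])
    show "(g has_derivative blinfun_apply (Jac g z)) (at z within UNIV)" for z
      using Jac_has_derivative[OF g] by simp
    show "onorm (blinfun_apply (Jac g z)) \<le> M" for z
      using M by (simp add: norm_blinfun.rep_eq)
  qed auto
  have "norm (adjoint (blinfun_apply (Jac g x - Jac g y)) (Y_proj \<eta> (g x)))
      \<le> norm (Jac g x - Jac g y) * norm (Y_proj \<eta> (g x))"
    by (rule norm_adjoint_blinfun_le)
  also have "\<dots> \<le> (L * norm (x - y)) * real CARD('m)"
    using lipschitz_onD[OF lip, of x y] norm_Y_set_le(2)[OF Y_proj_in_Y_set[OF \<eta>]] L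
    by (intro mult_mono) (auto simp: dist_norm)
  finally have 1: "norm (adjoint (blinfun_apply (Jac g x - Jac g y)) (Y_proj \<eta> (g x)))
      \<le> L * norm (x - y) * real CARD('m)" .
  have "norm (adjoint (blinfun_apply (Jac g y)) (Y_proj \<eta> (g x) - Y_proj \<eta> (g y)))
      \<le> norm (Jac g y) * norm (Y_proj \<eta> (g x) - Y_proj \<eta> (g y))"
    by (rule norm_adjoint_blinfun_le)
  also have "\<dots> \<le> M * (norm (g x - g y) / \<eta>)"
    using M M0 by (intro mult_mono Y_proj_lipschitz \<eta>) auto
  also have "\<dots> \<le> M * (M * norm (x - y) / \<eta>)"
    using gl M0 \<eta> by (intro mult_left_mono divide_right_mono) auto
  finally have 2: "norm (adjoint (blinfun_apply (Jac g y)) (Y_proj \<eta> (g x) - Y_proj \<eta> (g y)))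
      \<le> M * (M * norm (x - y) / \<eta>)" .
  show "dist (grad (r_smooth \<eta> g) x) (grad (r_smooth \<eta> g) y)
      \<le> (real CARD('m) * L + M\<^sup>2 / \<eta>) * dist x y"
    unfolding dist_norm gr adjoint_diff_split
    by (rule order_trans[OF norm_triangle_ineq])
      (use 1 2 in \<open>simp add: algebra_simps power2_eq_square\<close>)
qed

section \<open>Small gradients of the smoothed objective and approximate KKT points\<close>

lemma grad_F_smooth:
  fixes f :: "real^'n \<Rightarrow> real" and g :: "real^'n \<Rightarrow> real^'d^'m"
  assumes "\<eta> > 0" "f differentiable (at x)" "g differentiable (at x)"
  shows "GDERIV (F_smooth \<eta> f g) x :> grad f x + grad (r_smooth \<eta> g) x"
    and "grad (F_smooth \<eta> f g) x = grad f x + grad (r_smooth \<eta> g) x"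
proof -
  have "GDERIV (r_smooth \<eta> g) x :> grad (r_smooth \<eta> g) x"
    using r_smooth_GDERIV[OF assms(1,3)] grad_eqI by metis
  then have "GDERIV (\<lambda>x. f x + r_smooth \<eta> g x) x :> grad f x + grad (r_smooth \<eta> g) x"
    using GDERIV_grad[OF assms(2)] by (intro GDERIV_add)
  moreover have "F_smooth \<eta> f g = (\<lambda>x. f x + r_smooth \<eta> g x)"
    by (auto simp: F_smooth_def)
  ultimately show "GDERIV (F_smooth \<eta> f g) x :> grad f x + grad (r_smooth \<eta> g) x"
    by simp
  then show "grad (F_smooth \<eta> f g) x = grad f x + grad (r_smooth \<eta> g) x"
    by (rule grad_eqI)
qed

text \<open>Here \<open>2 \<mu>\<^sub>i = 1 / y\<^sub>i\<close> with \<open>y\<^sub>i = max \<epsilon> (norm (g\<^sub>i x))\<close>, and \<open>\<lambda> = 0\<close>.\<close>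

lemma eps_KKT_if_small_grad:
  fixes f :: "real^'n \<Rightarrow> real" and g :: "real^'n \<Rightarrow> real^'d^'m"
  assumes \<epsilon>: "\<epsilon> > 0" and f: "f differentiable (at x)" and g: "g differentiable (at x)"
    and small: "norm (grad (F_smooth \<epsilon> f g) x) \<le> \<epsilon>"
  shows "eps_KKT f g \<epsilon> x"
proof -
  define y where "y i = max \<epsilon> (norm (g x $ i))" for i
  define \<mu> where "\<mu> i = 1 / (2 * y i)" for i
  have y: "y i > 0" "y i \<ge> norm (g x $ i)" for i
    using \<epsilon> by (auto simp: y_def)
  let ?S = "\<Sum>i\<in>UNIV. \<mu> i *\<^sub>R adjoint (blinfun_apply (Jac (\<lambda>z. g z $ i) x)) (g x $ i)"
  have Y: "2 * \<mu> i * (w \<bullet> g x $ i) = w \<bullet> Y_proj \<epsilon> (g x) $ i" for i w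
    by (simp add: Y_proj_def \<mu>_def y_def)
  \<comment> \<open>Tested against an arbitrary \<open>v\<close>, the weighted sum over blocks
    reassembles into the gradient of the penalty.\<close>
  have "v \<bullet> (2 *\<^sub>R ?S) = v \<bullet> adjoint (blinfun_apply (Jac g x)) (Y_proj \<epsilon> (g x))" for v
  proof -
    have "v \<bullet> (2 *\<^sub>R ?S) = (\<Sum>i\<in>UNIV. 2 * \<mu> i * (blinfun_apply (Jac g x) v $ i \<bullet> g x $ i))"
      unfolding inner_scaleR_right inner_sum_right inner_adjoint_blinfun Jac_component[OF g]
        sum_distrib_left by (simp only: mult.assoc)
    also have "\<dots> = blinfun_apply (Jac g x) v \<bullet> Y_proj \<epsilon> (g x)"
      unfolding Y inner_vec_def[where 'b = 'm] by (rule refl)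
    finally show ?thesis
      by (simp only: inner_adjoint_blinfun)
  qed
  then have "2 *\<^sub>R ?S = adjoint (blinfun_apply (Jac g x)) (Y_proj \<epsilon> (g x))"
    using vector_eq_ldot by blast
  then have "2 *\<^sub>R ?S = grad (r_smooth \<epsilon> g) x"
    using r_smooth_GDERIV[OF \<epsilon> g] grad_eqI by metis
  then have "norm (grad f x + 2 *\<^sub>R ?S) \<le> \<epsilon>"
    using small grad_F_smooth(2)[OF \<epsilon> f g] by simp
  \<comment> \<open>For a block of norm above \<open>\<epsilon>\<close> the product is 0, because
    \<open>y i\<close> equals that norm; otherwise \<open>y i = \<epsilon>\<close> and the product
    is at most \<open>\<epsilon> / 2\<close>.\<close>
  moreover have "\<bar>\<mu> i * ((norm (g x $ i))\<^sup>2 - (y i)\<^sup>2)\<bar> \<le> \<epsilon>" for i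
  proof (cases "norm (g x $ i) \<le> \<epsilon>")
    case True
    then have "(norm (g x $ i))\<^sup>2 \<le> \<epsilon>\<^sup>2"
      by (intro power_mono) auto
    then have "\<bar>(norm (g x $ i))\<^sup>2 - \<epsilon>\<^sup>2\<bar> \<le> \<epsilon>\<^sup>2"
      by (smt (verit) zero_le_power2)
    then have "\<bar>(norm (g x $ i))\<^sup>2 - \<epsilon>\<^sup>2\<bar> / (2 * \<epsilon>) \<le> \<epsilon>\<^sup>2 / (2 * \<epsilon>)"
      using \<epsilon> by (intro divide_right_mono) auto
    also have "\<dots> \<le> \<epsilon>"
      using \<epsilon> by (simp add: power2_eq_square)
    finally show ?thesis
      using True \<epsilon> by (simp add: \<mu>_def y_def max_def abs_mult)
  next
    case False
    then show ?thesis
      using \<epsilon> by (simp add: y_def max_def)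
  qed
  moreover have "1 - 2 * \<mu> i * y i - 0 = 0" "0 \<le> \<mu> i" for i
    using y(1)[of i] by (simp_all add: \<mu>_def)
  ultimately show ?thesis
    unfolding eps_KKT_def using y by (intro exI[of _ \<mu>] exI[of _ "\<lambda>i. 0"] exI[of _ y]) auto
qed

section \<open>Decrease in one step of Res-GD\<close>

text \<open>The step returns the candidate with the smaller value, so its value is at most that of
  \<open>v\<close>, which is the gradient step of length \<open>a\<close> for the smoothed
  objective.\<close>

lemma res_gd_step_decrease:
  fixes f :: "real^'n \<Rightarrow> real" and g :: "real^'n \<Rightarrow> real^'d^'m"
  assumes \<eta>: "\<eta> > 0" and f: "\<And>x. f differentiable (at x)" and g: "\<And>x. g differentiable (at x)"
    and lip: "L-lipschitz_on UNIV (grad (F_smooth \<eta> f g))"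
    and L: "L > 0" and step_consts: "\<beta> > 1" "\<alpha> > \<beta>"
    and a: "inverse (\<alpha> * L) \<le> a" "a \<le> inverse (\<beta> * L)"
  shows "F_smooth \<eta> f g (res_gd_step \<eta> f g a b x) \<le>
    F_smooth \<eta> f g x - (\<beta> - 1) / (2 * \<alpha>\<^sup>2 * L) * (norm (grad (F_smooth \<eta> f g) x))\<^sup>2"
proof -
  have der: "GDERIV (F_smooth \<eta> f g) x :> grad (F_smooth \<eta> f g) x" for x
    using grad_F_smooth[OF \<eta> f g] by metis
  have "x - a *\<^sub>R grad (F_smooth \<eta> f g) x = x - a *\<^sub>R grad f x - a *\<^sub>R grad (r_smooth \<eta> g) x"
    by (simp add: grad_F_smooth(2)[OF \<eta> f g] scaleR_add_right)
  then have "F_smooth \<eta> f g (res_gd_step \<eta> f g a b x)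
      \<le> F_smooth \<eta> f g (x - a *\<^sub>R grad (F_smooth \<eta> f g) x)"
    by (simp only: res_gd_step_def Let_def split: if_split) linarith
  also note gradient_step_decrease[OF der lip L step_consts a]
  finally show ?thesis .
qed

section \<open>Coercive functions and accumulation points\<close>

lemma coercive_sublevel_bounded:
  fixes F :: "'a::real_normed_vector \<Rightarrow> real"
  assumes "filterlim F at_top at_infinity"
  shows "bounded {x. F x \<le> C}"
proof -
  obtain b where b: "\<And>x. norm x \<ge> b \<Longrightarrow> F x \<ge> C + 1"
    using assms unfolding filterlim_at_top eventually_at_infinity by blast
  have "norm x \<le> b" if "F x \<le> C" for x
    using b[of x] that by linarith
  then show ?thesis
    unfolding bounded_iff by blast
qed

text \<open>The closure of the sublevel set at 0 is compact, so \<open>F\<close> is bounded there;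
  elsewhere \<open>F\<close> is positive.\<close>

lemma coercive_bounded_below:
  fixes F :: "'a::euclidean_space \<Rightarrow> real"
  assumes lim: "filterlim F at_top at_infinity" and cont: "continuous_on UNIV F"
  obtains l where "\<And>x. l \<le> F x"
proof -
  have "bounded (F ` closure {x. F x \<le> 0})"
    using coercive_sublevel_bounded[OF lim] cont
    by (intro compact_imp_bounded compact_continuous_image)
      (auto intro: continuous_on_subset simp: compact_closure)
  then obtain b where b: "\<And>x. x \<in> closure {x. F x \<le> 0} \<Longrightarrow> \<bar>F x\<bar> \<le> b"
    unfolding bounded_iff by auto
  have "min 0 (- b) \<le> F x" for x
  proof (cases "F x \<le> 0")
    case True
    then have "x \<in> closure {x. F x \<le> 0}"
      using closure_subset by fastforce
    with b[of x] show ?thesis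
      by linarith
  qed auto
  then show thesis
    by (rule that)
qed

lemma bounded_range_accumulation_point:
  fixes X :: "nat \<Rightarrow> 'a::euclidean_space"
  assumes "bounded (range X)"
  obtains p where "p \<in> accumulation_points X"
  using bounded_imp_convergent_subsequence[OF assms] unfolding accumulation_points_def by blast

section \<open>Convergence and complexity for a fixed smoothing parameter\<close>

text \<open>The third claim exhibits \<open>Fs\<close> as an attained value, so that it can later be
  bounded below uniformly in \<open>\<eta>\<close>. The free upper bound \<open>B\<close> in the
  fourth serves the iteration bounds with \<open>F_fun f g x0\<close> and with
  \<open>F_smooth \<eta> f g x0\<close> alike.\<close>

lemma res_gd_convergence:
  fixes f :: "real^'n \<Rightarrow> real"
    and g :: "real^'n \<Rightarrow> real^'d^'m"
    and L\<^sub>f L\<^sub>g M \<alpha> \<beta> \<eta> :: real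
    and x0 :: "real^'n"
    and as bs :: "nat \<Rightarrow> real"
  defines "X \<equiv> res_gd \<eta> f g as bs x0"
    and "L \<equiv> L_smooth L\<^sub>f L\<^sub>g M CARD('m) \<eta>"
    and "Fs \<equiv> F_star \<eta> f g as bs x0"
  assumes A1: "continuously_differentiable g" "L\<^sub>g > 0" "L\<^sub>g-lipschitz_on UNIV (Jac g)"
    and A2: "M > 0" "\<forall>x. norm (Jac g x) \<le> M"
    and A3: "continuously_differentiable f" "L\<^sub>f-lipschitz_on UNIV (grad f)"
    and A4: "filterlim (F_fun f g) at_top at_infinity"
    and step_consts: "\<beta> > 1" "\<alpha> > \<beta>"
    and \<eta>: "\<eta> > 0" and steps: "admissible_steps \<alpha> \<beta> L as bs"
  shows "bounded (range X)"
    and "p \<in> accumulation_points X \<Longrightarrow> F_smooth \<eta> f g p = Fs \<and> grad (F_smooth \<eta> f g) p = 0"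
    and "\<exists>p. Fs = F_smooth \<eta> f g p \<and> Fs \<le> F_smooth \<eta> f g x0"
    and "\<epsilon> > 0 \<Longrightarrow> 2 * \<alpha>\<^sup>2 * L * (F_smooth \<eta> f g x0 - Fs) / ((\<beta> - 1) * \<epsilon>\<^sup>2) \<le> B \<Longrightarrow>
      \<exists>k. int k \<le> \<lfloor>B\<rfloor> + 1 \<and> norm (grad (F_smooth \<eta> f g) (X k)) \<le> \<epsilon>"
proof -
  let ?F = "F_smooth \<eta> f g"
  define c where "c = (\<beta> - 1) / (2 * \<alpha>\<^sup>2 * L)"
  have f: "\<And>x. f differentiable (at x)" and g: "\<And>x. g differentiable (at x)"
    using A1 A3 by (auto simp: continuously_differentiable_def)
  have "L\<^sub>f \<ge> 0"
    using A3(2) lipschitz_on_nonneg by blast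
  then have L: "L > 0"
    using A1(2) A2(1) \<eta> by (simp add: L_def L_smooth_def add_nonneg_pos)
  then have c: "c > 0"
    using step_consts by (simp add: c_def)
  have "(L\<^sub>f + (real CARD('m) * L\<^sub>g + M\<^sup>2 / \<eta>))-lipschitz_on UNIV (\<lambda>x. grad f x + grad (r_smooth \<eta> g) x)"
    using A2 by (intro lipschitz_on_add A3 grad_r_smooth_lipschitz \<eta> g A1) auto
  moreover have "grad ?F = (\<lambda>x. grad f x + grad (r_smooth \<eta> g) x)"
    using grad_F_smooth(2)[OF \<eta> f g] by blast
  ultimately have lip: "L-lipschitz_on UNIV (grad ?F)"
    by (simp add: L_def L_smooth_def add.assoc)
  have dec: "?F (X (Suc k)) \<le> ?F (X k) - c * (norm (grad ?F (X k)))\<^sup>2" for k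
    using res_gd_step_decrease[OF \<eta> f g lip L step_consts] steps
    unfolding X_def c_def admissible_steps_def by simp
  have contF: "continuous_on UNIV ?F"
    using grad_F_smooth(1)[OF \<eta> f g] has_derivative_continuous
    unfolding gderiv_def by (intro continuous_at_imp_continuous_on) blast
  have contG: "continuous_on UNIV (grad ?F)"
    using lip by (rule lipschitz_on_continuous_on)
  note acc = sufficient_decrease_accumulation[where F = ?F and G = "grad ?F" and X = X, OF dec c contF contG]
  have X0: "X 0 = x0"
    by (simp add: X_def)
  have "?F (X k) \<le> ?F x0" for k
  proof (induction k)
    case (Suc k)
    then show ?case
      using dec[of k] c by (smt (verit) mult_nonneg_nonneg zero_le_power2)
  qed (simp add: X0)
  \<comment> \<open>Coercivity is assumed of \<open>F_fun\<close>, so the monotone values of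
    \<open>F_smooth\<close> are first converted into a sublevel set of \<open>F_fun\<close>.\<close>
  then have "F_fun f g (X k) \<le> ?F x0 + \<eta> / 2 * real CARD('m)" for k
    using r_fun_le_r_smooth[OF \<eta>, of g "X k"]
    by (smt (verit) F_fun_def F_smooth_def)
  then show bdd: "bounded (range X)"
    by (intro bounded_subset[OF coercive_sublevel_bounded[OF A4]]) blast
  then obtain q where q: "q \<in> accumulation_points X"
    using bounded_range_accumulation_point by blast
  have val: "?F p = ?F q" if "p \<in> accumulation_points X" for p
    using acc(1)[OF that] acc(1)[OF q] LIMSEQ_unique by blast
  \<comment> \<open>The image is a singleton, nonempty because of \<open>q\<close>; this gives
    \<open>the_elem\<close> in \<open>F_star\<close> its meaning.\<close>
  have "?F ` accumulation_points X = {?F q}"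
    using val q by blast
  then have Fs: "Fs = ?F q"
    by (simp add: Fs_def F_star_def X_def)
  show "?F p = Fs \<and> grad ?F p = 0" if "p \<in> accumulation_points X"
    using that val acc(3) Fs by metis
  show "\<exists>p. Fs = ?F p \<and> Fs \<le> ?F x0"
    using Fs acc(2)[OF q, of 0] X0 by auto
  assume \<epsilon>: "\<epsilon> > 0" and B: "2 * \<alpha>\<^sup>2 * L * (?F x0 - Fs) / ((\<beta> - 1) * \<epsilon>\<^sup>2) \<le> B"
  have "(?F (X 0) - Fs) / (c * \<epsilon>\<^sup>2) = 2 * \<alpha>\<^sup>2 * L * (?F x0 - Fs) / ((\<beta> - 1) * \<epsilon>\<^sup>2)"
    using step_consts L \<epsilon> by (simp add: c_def X0 field_simps)
  then show "\<exists>k. int k \<le> \<lfloor>B\<rfloor> + 1 \<and> norm (grad ?F (X k)) \<le> \<epsilon>"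
    using B acc(2)[OF q] Fs
    by (intro sufficient_decrease_complexity[where F = ?F and G = "grad ?F" and X = X and l = Fs, OF dec c _ \<epsilon>]) auto
qed

text \<open>Admissible step sizes change with the smoothing parameter, so the asymptotic claim
  quantifies over families \<open>As\<close> and \<open>Bs\<close> indexed by
  \<open>\<epsilon>\<close>.\<close>

theorem theorem1:
  fixes f :: "real^'n \<Rightarrow> real"
    and g :: "real^'n \<Rightarrow> real^'d^'m"
    and L\<^sub>f L\<^sub>g M \<alpha> \<beta> :: real
    and x0 :: "real^'n"
  assumes A1: "continuously_differentiable g" "L\<^sub>g > 0" "L\<^sub>g-lipschitz_on UNIV (Jac g)"
    and A2: "M > 0" "\<forall>x. norm (Jac g x) \<le> M"
    and A3: "continuously_differentiable f" "L\<^sub>f-lipschitz_on UNIV (grad f)"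
    and A4: "filterlim (F_fun f g) at_top at_infinity"
    and step_consts: "\<beta> > 1" "\<alpha> > \<beta>"
  shows
    "(\<forall>\<eta> as bs. \<eta> > 0 \<and> admissible_steps \<alpha> \<beta> (L_smooth L\<^sub>f L\<^sub>g M CARD('m) \<eta>) as bs \<longrightarrow>
        bounded (range (res_gd \<eta> f g as bs x0)) \<and>
        (\<forall>p \<in> accumulation_points (res_gd \<eta> f g as bs x0).
           F_smooth \<eta> f g p = F_star \<eta> f g as bs x0 \<and> grad (F_smooth \<eta> f g) p = 0) \<and>
        (\<forall>\<epsilon>>0. \<exists>k. int k \<le> \<lfloor>2 * \<alpha>\<^sup>2 * L_smooth L\<^sub>f L\<^sub>g M CARD('m) \<eta> *
                               (F_fun f g x0 - F_star \<eta> f g as bs x0) / ((\<beta> - 1) * \<epsilon>\<^sup>2)\<rfloor> + 1 \<and>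
                   norm (grad (F_smooth \<eta> f g) (res_gd \<eta> f g as bs x0 k)) \<le> \<epsilon>)) \<and>
     (\<forall>\<epsilon> as bs. \<epsilon> > 0 \<and> admissible_steps \<alpha> \<beta> (L_smooth L\<^sub>f L\<^sub>g M CARD('m) \<epsilon>) as bs \<longrightarrow>
        (\<exists>k. int k \<le> KKT_bound f g L\<^sub>f L\<^sub>g M \<alpha> \<beta> as bs x0 \<epsilon> \<and>
             eps_KKT f g \<epsilon> (res_gd \<epsilon> f g as bs x0 k))) \<and>
     (\<forall>As Bs :: real \<Rightarrow> nat \<Rightarrow> real.
        (\<forall>\<epsilon>>0. admissible_steps \<alpha> \<beta> (L_smooth L\<^sub>f L\<^sub>g M CARD('m) \<epsilon>) (As \<epsilon>) (Bs \<epsilon>)) \<longrightarrow>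
        (\<lambda>\<epsilon>. real_of_int (KKT_bound f g L\<^sub>f L\<^sub>g M \<alpha> \<beta> (As \<epsilon>) (Bs \<epsilon>) x0 \<epsilon>))
          \<in> O[at_right 0](\<lambda>\<epsilon>. 1 / \<epsilon> ^ 3))"
proof (intro conjI allI impI)
  have f: "\<And>x. f differentiable (at x)" and g: "\<And>x. g differentiable (at x)"
    using A1 A3 by (auto simp: continuously_differentiable_def)
  have Lf: "L\<^sub>f \<ge> 0"
    using A3(2) lipschitz_on_nonneg by blast
  note conv = res_gd_convergence[OF A1 A2 A3 A4 step_consts]
  {
    fix \<eta> as bs
    assume "\<eta> > 0 \<and> admissible_steps \<alpha> \<beta> (L_smooth L\<^sub>f L\<^sub>g M CARD('m) \<eta>) as bs"
    then have \<eta>: "\<eta> > 0" and steps: "admissible_steps \<alpha> \<beta> (L_smooth L\<^sub>f L\<^sub>g M CARD('m) \<eta>) as bs"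
      by auto
    show "bounded (range (res_gd \<eta> f g as bs x0))"
      by (rule conv(1)[OF \<eta> steps])
    show "\<forall>p \<in> accumulation_points (res_gd \<eta> f g as bs x0).
        F_smooth \<eta> f g p = F_star \<eta> f g as bs x0 \<and> grad (F_smooth \<eta> f g) p = 0"
      using conv(2)[OF \<eta> steps] by blast
    fix \<epsilon> :: real
    assume \<epsilon>: "\<epsilon> > 0"
    \<comment> \<open>A nonnegative factor ensures that the larger initial value
      \<open>F_fun f g x0\<close> only enlarges the bound.\<close>
    have "L_smooth L\<^sub>f L\<^sub>g M CARD('m) \<eta> \<ge> 0"
      using Lf A1(2) \<eta> by (simp add: L_smooth_def)
    moreover have "F_smooth \<eta> f g x0 \<le> F_fun f g x0"
      using r_smooth_le_r_fun[OF \<eta>] by (simp add: F_smooth_def F_fun_def)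
    ultimately show "\<exists>k. int k \<le> \<lfloor>2 * \<alpha>\<^sup>2 * L_smooth L\<^sub>f L\<^sub>g M CARD('m) \<eta> *
          (F_fun f g x0 - F_star \<eta> f g as bs x0) / ((\<beta> - 1) * \<epsilon>\<^sup>2)\<rfloor> + 1 \<and>
        norm (grad (F_smooth \<eta> f g) (res_gd \<eta> f g as bs x0 k)) \<le> \<epsilon>"
      using step_consts
      by (intro conv(4)[OF \<eta> steps \<epsilon>] divide_right_mono mult_left_mono) auto
  }
  {
    fix \<epsilon> as bs
    assume "\<epsilon> > 0 \<and> admissible_steps \<alpha> \<beta> (L_smooth L\<^sub>f L\<^sub>g M CARD('m) \<epsilon>) as bs"
    then have \<epsilon>: "\<epsilon> > 0" and steps: "admissible_steps \<alpha> \<beta> (L_smooth L\<^sub>f L\<^sub>g M CARD('m) \<epsilon>) as bs"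
      by auto
    show "\<exists>k. int k \<le> KKT_bound f g L\<^sub>f L\<^sub>g M \<alpha> \<beta> as bs x0 \<epsilon> \<and>
        eps_KKT f g \<epsilon> (res_gd \<epsilon> f g as bs x0 k)"
    proof -
      define L where "L = L_smooth L\<^sub>f L\<^sub>g M CARD('m) \<epsilon>"
      define d where "d = F_smooth \<epsilon> f g x0 - F_star \<epsilon> f g as bs x0"
      define B where "B = 2 * d * \<alpha>\<^sup>2 * L / ((\<beta> - 1) * \<epsilon>\<^sup>2)"
      have KKT: "KKT_bound f g L\<^sub>f L\<^sub>g M \<alpha> \<beta> as bs x0 \<epsilon> = \<lfloor>B\<rfloor> + 1"
        by (simp only: KKT_bound_def B_def d_def L_def L_smooth_def)
      have "2 * \<alpha>\<^sup>2 * L * d / ((\<beta> - 1) * \<epsilon>\<^sup>2) \<le> B"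
        by (simp add: B_def mult.commute mult.left_commute)
      note B = this[unfolded L_def d_def]
      obtain k where "int k \<le> KKT_bound f g L\<^sub>f L\<^sub>g M \<alpha> \<beta> as bs x0 \<epsilon>"
        "norm (grad (F_smooth \<epsilon> f g) (res_gd \<epsilon> f g as bs x0 k)) \<le> \<epsilon>"
        using conv(4)[OF \<epsilon> steps \<epsilon>, of x0, OF B] unfolding KKT by blast
      then show ?thesis
        using eps_KKT_if_small_grad[OF \<epsilon> f g] by blast
    qed
  }
  fix As Bs :: "real \<Rightarrow> nat \<Rightarrow> real"
  assume steps: "\<forall>\<epsilon>>0. admissible_steps \<alpha> \<beta> (L_smooth L\<^sub>f L\<^sub>g M CARD('m) \<epsilon>) (As \<epsilon>) (Bs \<epsilon>)"
  have "continuous_on UNIV f" "continuous_on UNIV g"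
    using f g by (auto intro!: continuous_at_imp_continuous_on differentiable_imp_continuous_within)
  then have "continuous_on UNIV (F_fun f g)"
    unfolding F_fun_def[abs_def] r_fun_def by (intro continuous_intros)
  then obtain l where l: "\<And>x. l \<le> F_fun f g x"
    using coercive_bounded_below[OF A4] by blast
  \<comment> \<open>For \<open>\<epsilon> < 1\<close>, \<open>D\<close> dominates the gap between
    the initial and limiting smoothed values, and \<open>K / \<epsilon>\<close> dominates the
    Lipschitz constant; neither \<open>D\<close> nor \<open>K\<close> depends on
    \<open>\<epsilon>\<close> or on the step sizes.\<close>
  define D where "D = F_fun f g x0 - l + real CARD('m) / 2"
  define K where "K = L\<^sub>f + real CARD('m) * L\<^sub>g + M\<^sup>2"
  show "(\<lambda>\<epsilon>. real_of_int (KKT_bound f g L\<^sub>f L\<^sub>g M \<alpha> \<beta> (As \<epsilon>) (Bs \<epsilon>) x0 \<epsilon>))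
      \<in> O[at_right 0](\<lambda>\<epsilon>. 1 / \<epsilon> ^ 3)"
  \<comment> \<open>The final summand 1 absorbs the \<open>+ 1\<close> of the bound, since
    \<open>1 \<le> 1 / \<epsilon> ^ 3\<close> for \<open>\<epsilon>\<close> below 1.\<close>
  proof (rule bigoI[where c = "2 * D * \<alpha>\<^sup>2 * K / (\<beta> - 1) + 1"])
    have "norm (real_of_int (KKT_bound f g L\<^sub>f L\<^sub>g M \<alpha> \<beta> (As \<epsilon>) (Bs \<epsilon>) x0 \<epsilon>))
        \<le> (2 * D * \<alpha>\<^sup>2 * K / (\<beta> - 1) + 1) * norm (1 / \<epsilon> ^ 3)" if \<epsilon>: "0 < \<epsilon>" "\<epsilon> < 1" for \<epsilon>
    proof -
      define d where "d = F_smooth \<epsilon> f g x0 - F_star \<epsilon> f g (As \<epsilon>) (Bs \<epsilon>) x0"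
      define k where "k = L\<^sub>f + real CARD('m) * L\<^sub>g + M\<^sup>2 / \<epsilon>"
      define b where "b = 2 * d * \<alpha>\<^sup>2 * k / ((\<beta> - 1) * \<epsilon>\<^sup>2)"
      obtain p where p: "F_star \<epsilon> f g (As \<epsilon>) (Bs \<epsilon>) x0 = F_smooth \<epsilon> f g p" and d0: "0 \<le> d"
        using conv(3)[OF \<epsilon>(1), of "As \<epsilon>" "Bs \<epsilon>" x0] steps \<epsilon>(1) unfolding d_def by fastforce
      have "l - real CARD('m) / 2 \<le> F_fun f g p - \<epsilon> / 2 * real CARD('m)"
        using l[of p] \<epsilon> by (intro diff_mono) auto
      then have "l - real CARD('m) / 2 \<le> F_smooth \<epsilon> f g p"
        using r_fun_le_r_smooth[OF \<epsilon>(1), of g p] by (simp add: F_smooth_def F_fun_def)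
      then have dD: "d \<le> D"
        using r_smooth_le_r_fun[OF \<epsilon>(1), of g x0] p by (simp add: d_def D_def F_smooth_def F_fun_def)
      have k0: "0 \<le> k"
        unfolding k_def using Lf A1(2) \<epsilon> by simp
      have "\<epsilon> * L\<^sub>f \<le> L\<^sub>f" "\<epsilon> * (real CARD('m) * L\<^sub>g) \<le> real CARD('m) * L\<^sub>g"
        using Lf A1(2) \<epsilon> by (simp_all add: mult_left_le_one_le)
      then have "(\<epsilon> * L\<^sub>f + \<epsilon> * (real CARD('m) * L\<^sub>g) + M\<^sup>2) / \<epsilon> \<le> K / \<epsilon>"
        unfolding K_def using \<epsilon> by (intro divide_right_mono add_mono order_refl) auto
      then have kK: "k \<le> K / \<epsilon>"
        using \<epsilon> by (simp add: k_def add_divide_distrib)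
      have e3: "1 \<le> 1 / \<epsilon> ^ 3"
        using \<epsilon> by (simp add: power_le_one)
      have b0: "0 \<le> b"
        unfolding b_def using d0 k0 step_consts by simp
      have "b \<le> 2 * D * \<alpha>\<^sup>2 * (K / \<epsilon>) / ((\<beta> - 1) * \<epsilon>\<^sup>2)"
        unfolding b_def using dD d0 kK k0 step_consts by (intro divide_right_mono mult_mono) auto
      also have "\<dots> = 2 * D * \<alpha>\<^sup>2 * K / (\<beta> - 1) * (1 / \<epsilon> ^ 3)"
        by (simp add: power2_eq_square power3_eq_cube)
      finally have "b + 1 \<le> (2 * D * \<alpha>\<^sup>2 * K / (\<beta> - 1) + 1) * (1 / \<epsilon> ^ 3)"
        using e3 unfolding distrib_right mult_1 by (rule add_mono)
      moreover have "norm (real_of_int (\<lfloor>b\<rfloor> + 1)) \<le> b + 1"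
        using b0 by simp
      moreover have "KKT_bound f g L\<^sub>f L\<^sub>g M \<alpha> \<beta> (As \<epsilon>) (Bs \<epsilon>) x0 \<epsilon> = \<lfloor>b\<rfloor> + 1"
        by (simp only: KKT_bound_def b_def d_def k_def)
      moreover have "norm (1 / \<epsilon> ^ 3) = 1 / \<epsilon> ^ 3"
        using \<epsilon> by simp
      ultimately show ?thesis
        by (metis order_trans)
    qed
    then show "\<forall>\<^sub>F \<epsilon> in at_right 0.
        norm (real_of_int (KKT_bound f g L\<^sub>f L\<^sub>g M \<alpha> \<beta> (As \<epsilon>) (Bs \<epsilon>) x0 \<epsilon>))
        \<le> (2 * D * \<alpha>\<^sup>2 * K / (\<beta> - 1) + 1) * norm (1 / \<epsilon> ^ 3)"
      using eventually_at_right_real[of 0 1] by (auto elim!: eventually_mono)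
  qed
qed

end
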